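(* Let $(X_\infty,f_\infty)$ be a topological nonautonomous dynamical system which is (uniformly) equicontinuous, let $\mu_\infty=(\mu_n)_{n\ge 0}$ be an invariant measure sequence of Borel probability measures for it, and let $\varphi_\infty=(\varphi_n)_{n\ge 0}$ be a uniformly equicontinuous and uniformly bounded sequence of functions $\varphi_n:X_n\to\mathbb{R}$. Then $$P_{\mu_\infty}(f_\infty;\varphi_\infty)\le P_{\mathrm{top}}(f_\infty;\varphi_\infty).$$
   Context: A topological nonautonomous dynamical system (NDS) $(X_\infty,f_\infty)$ consists of compact metric spaces $(X_n,d_n)$, $n\ge 0$, and continuous maps $f_n:X_n\to X_{n+1}$. Put $f_k^n:=f_{k+n-1}\circ\cdots\circ f_k$, $f_k^0:=\mathrm{id}_{X_k}$, $f_k^{-n}:=(f_k^n)^{-1}$ (applied to sets). The NDS is equicontinuous if for every $\varepsilon>0$ there is $\delta>0$ such that for all $n$, $d_n(x,y)<\delta$ implies $d_{n+1}(f_n(x),f_n(y))<\varepsilon$; $\varphi_\infty$ is uniformly equicontinuous if for every $\varepsilon>0$ there is $\delta>0$ such that for all $n$, $d_n(x,y)<\delta$ implies $|\varphi_n(x)-\varphi_n(y)|<\varepsilon$. An invariant measure sequence (IMS) is a sequence $\mu_n$ of Borel probability measures on $X_n$ such that the push-forward of $\mu_n$ under $f_n$ is $\mu_{n+1}$ for all $n$. Metric entropy: for a sequence $\mathcal{P}_\infty=(\mathcal{P}_n)_{n\ge0}$ of finite Borel partitions of the $X_n$, $h(f_\infty;\mathcal{P}_\infty;\mu_\infty):=\limsup_{n\to\infty}\frac1n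 H_{\mu_0}\big(\bigvee_{i=0}^{n-1}f_0^{-i}\mathcal{P}_i\big)$, with $H_{\mu_0}$ the usual Shannon entropy of a partition. The class $\mathcal{E}_{\mathrm M}$ consists of all sequences $\mathcal{P}_\infty$, $\mathcal{P}_n=\{P_{n,1},\dots,P_{n,k_n}\}$, with $\sup_n k_n<\infty$ such that for every $\varepsilon>0$ there are $\delta>0$ and compact sets $K_{n,i}\subset P_{n,i}$ with $\mu_n(P_{n,i}\setminus K_{n,i})\le\varepsilon$ and $\min_{1\le i<j\le k_n}\min_{(x,y)\in K_{n,i}\times K_{n,j}}d_n(x,y)\ge\delta$ for all $n\ge0$. Set $h_{\mathcal{E}_{\mathrm M}}(f_\infty;\mu_\infty):=\sup_{\mathcal{P}_\infty\in\mathcal{E}_{\mathrm M}}h(f_\infty;\mathcal{P}_\infty;\mu_\infty)$. Write $S_n\varphi_\infty(x):=\sum_{i=0}^{n-1}\varphi_i(f_0^i(x))$ for $x\in X_0$. Metric pressure: $P_{\mu_\infty}(f_\infty;\varphi_\infty):=h_{\mathcal{E}_{\mathrm M}}(f_\infty;\mu_\infty)+\liminf_{n\to\infty}\frac1n\int_{X_0}S_n\varphi_\infty\,d\mu_0$. Topological pressure: let $d_{0,n}(x,y):=\max_{0\le j\le n}d_j(f_0^j(x),f_0^j(y))$ on $X_0$. A set $E\subset X_0$ is $(n,\varepsilon)$-separated if $d_{0,n}(x,y)\ge\varepsilon$ for all distinct $x,y\in E$; $F\subset X_0$ is $(n,\varepsilon)$-spanning if every $x\in X_0$ has some $y\in F$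 with $d_{0,n}(x,y)<\varepsilon$. Let $S(n,\varepsilon;\varphi_\infty)$ be the supremum of $\sum_{x\in E}e^{S_n\varphi_\infty(x)}$ over $(n,\varepsilon)$-separated $E$, and $R(n,\varepsilon;\varphi_\infty)$ the infimum of $\sum_{x\in F}e^{S_n\varphi_\infty(x)}$ over $(n,\varepsilon)$-spanning $F$. Then $P_{\mathrm{top}}(f_\infty;\varphi_\infty):=\lim_{\varepsilon\searrow0}\limsup_{n\to\infty}\frac1n\log S(n,\varepsilon;\varphi_\infty)=\lim_{\varepsilon\searrow0}\limsup_{n\to\infty}\frac1n\log R(n,\varepsilon;\varphi_\infty)$ (the two expressions coincide). Values in the extended reals are allowed. *)

theory Defs
  imports "HOL-Analysis.Analysis" "HOL-Probability.Probability"
begin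

text \<open>
  The spaces \<open>X n\<close> are bundled metric spaces whose points are taken from one common type
  \<open>'a\<close>. The carriers and metrics are unrelated for different \<open>n\<close>, so this
  covers arbitrary sequences of metric spaces (embed them into their disjoint union). Maps are total
  functions on \<open>'a\<close>, of which only the values on the carriers matter.
\<close>

definition nds :: "(nat \<Rightarrow> 'a metric) \<Rightarrow> (nat \<Rightarrow> 'a \<Rightarrow> 'a) \<Rightarrow> bool" where
  "nds X f \<longleftrightarrow>
     (\<forall>n. compact_space (mtopology_of (X n))) \<and>
     (\<forall>n. continuous_map (mtopology_of (X n)) (mtopology_of (X (Suc n))) (f n))"

definition nds_equicontinuous :: "(nat \<Rightarrow> 'a metric) \<Rightarrow> (nat \<Rightarrow> 'a \<Rightarrow> 'a) \<Rightarrow> bool" where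
  "nds_equicontinuous X f \<longleftrightarrow>
     (\<forall>\<epsilon>>0. \<exists>\<delta>>0. \<forall>n. \<forall>x\<in>mspace (X n). \<forall>y\<in>mspace (X n).
        mdist (X n) x y < \<delta> \<longrightarrow> mdist (X (Suc n)) (f n x) (f n y) < \<epsilon>)"

definition unif_equicontinuous :: "(nat \<Rightarrow> 'a metric) \<Rightarrow> (nat \<Rightarrow> 'a \<Rightarrow> real) \<Rightarrow> bool" where
  "unif_equicontinuous X \<phi> \<longleftrightarrow>
     (\<forall>\<epsilon>>0. \<exists>\<delta>>0. \<forall>n. \<forall>x\<in>mspace (X n). \<forall>y\<in>mspace (X n).
        mdist (X n) x y < \<delta> \<longrightarrow> \<bar>\<phi> n x - \<phi> n y\<bar> < \<epsilon>)"

definition unif_bounded :: "(nat \<Rightarrow> 'a metric) \<Rightarrow> (nat \<Rightarrow> 'a \<Rightarrow> real) \<Rightarrow> bool" where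
  "unif_bounded X \<phi> \<longleftrightarrow> (\<exists>C. \<forall>n. \<forall>x\<in>mspace (X n). \<bar>\<phi> n x\<bar> \<le> C)"

text \<open>\<open>nds_iter f k n\<close> is the composition of \<open>f k, \<dots>, f (k + n - 1)\<close>.\<close>

primrec nds_iter :: "(nat \<Rightarrow> 'a \<Rightarrow> 'a) \<Rightarrow> nat \<Rightarrow> nat \<Rightarrow> 'a \<Rightarrow> 'a" where
  "nds_iter f k 0 = id"
| "nds_iter f k (Suc n) = f (k + n) \<circ> nds_iter f k n"

definition metric_borel_sets :: "'a metric \<Rightarrow> 'a set set" where
  "metric_borel_sets M = sigma_sets (mspace M) {U. openin (mtopology_of M) U}"

definition ims :: "(nat \<Rightarrow> 'a metric) \<Rightarrow> (nat \<Rightarrow> 'a \<Rightarrow> 'a) \<Rightarrow> (nat \<Rightarrow> 'a measure) \<Rightarrow> bool" where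
  "ims X f \<mu> \<longleftrightarrow>
     (\<forall>n. prob_space (\<mu> n) \<and> space (\<mu> n) = mspace (X n) \<and> sets (\<mu> n) = metric_borel_sets (X n)) \<and>
     (\<forall>n. distr (\<mu> n) (\<mu> (Suc n)) (f n) = \<mu> (Suc n))"


text \<open>
  Partitions are sets of nonempty cells. Empty cells are discarded from preimages and joins, which
  changes no entropy because \<open>ln 0 = 0\<close> makes null cells contribute nothing.
\<close>

definition finite_borel_partition :: "'a metric \<Rightarrow> 'a set set \<Rightarrow> bool" where
  "finite_borel_partition M P \<longleftrightarrow>
     finite P \<and> partition_on (mspace M) P \<and> P \<subseteq> metric_borel_sets M"

definition partition_entropy :: "'a measure \<Rightarrow> 'a set set \<Rightarrow> real" where
  "partition_entropy M P = - (\<Sum>A\<in>P. measure M A * ln (measure M A))"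

definition preimage_partition ::
  "(nat \<Rightarrow> 'a metric) \<Rightarrow> (nat \<Rightarrow> 'a \<Rightarrow> 'a) \<Rightarrow> nat \<Rightarrow> 'a set set \<Rightarrow> 'a set set" where
  "preimage_partition X f i P = (\<lambda>A. nds_iter f 0 i -` A \<inter> mspace (X 0)) ` P - {{}}"

definition nds_join ::
  "(nat \<Rightarrow> 'a metric) \<Rightarrow> (nat \<Rightarrow> 'a \<Rightarrow> 'a) \<Rightarrow> (nat \<Rightarrow> 'a set set) \<Rightarrow> nat \<Rightarrow> 'a set set" where
  "nds_join X f P n = common_refinement ((\<lambda>i. preimage_partition X f i (P i)) ` {..<n})"

definition entropy_wrt ::
  "(nat \<Rightarrow> 'a metric) \<Rightarrow> (nat \<Rightarrow> 'a \<Rightarrow> 'a) \<Rightarrow> (nat \<Rightarrow> 'a set set) \<Rightarrow> (nat \<Rightarrow> 'a measure) \<Rightarrow> ereal" where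
  "entropy_wrt X f P \<mu> =
     limsup (\<lambda>n. ereal (1 / real n * partition_entropy (\<mu> 0) (nds_join X f P n)))"

text \<open>In the class below, \<open>K n A\<close> is the compact subset of the cell \<open>A\<close> of \<open>P n\<close>.\<close>

definition admissible_M ::
  "(nat \<Rightarrow> 'a metric) \<Rightarrow> (nat \<Rightarrow> 'a measure) \<Rightarrow> (nat \<Rightarrow> 'a set set) set" where
  "admissible_M X \<mu> = {P.
     (\<forall>n. finite_borel_partition (X n) (P n)) \<and>
     (\<exists>N. \<forall>n. card (P n) \<le> N) \<and>
     (\<forall>\<epsilon>>0. \<exists>\<delta>>0. \<exists>K. \<forall>n.
        (\<forall>A\<in>P n. K n A \<subseteq> A \<and> compactin (mtopology_of (X n)) (K n A) \<and>
           measure (\<mu> n) (A - K n A) \<le> \<epsilon>) \<and>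
        (\<forall>A\<in>P n. \<forall>B\<in>P n. A \<noteq> B \<longrightarrow> (\<forall>x\<in>K n A. \<forall>y\<in>K n B. \<delta> \<le> mdist (X n) x y)))}"

definition metric_entropy ::
  "(nat \<Rightarrow> 'a metric) \<Rightarrow> (nat \<Rightarrow> 'a \<Rightarrow> 'a) \<Rightarrow> (nat \<Rightarrow> 'a measure) \<Rightarrow> ereal" where
  "metric_entropy X f \<mu> = (SUP P\<in>admissible_M X \<mu>. entropy_wrt X f P \<mu>)"

definition birkhoff_sum :: "(nat \<Rightarrow> 'a \<Rightarrow> 'a) \<Rightarrow> (nat \<Rightarrow> 'a \<Rightarrow> real) \<Rightarrow> nat \<Rightarrow> 'a \<Rightarrow> real" where
  "birkhoff_sum f \<phi> n x = (\<Sum>i<n. \<phi> i (nds_iter f 0 i x))"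

definition metric_pressure ::
  "(nat \<Rightarrow> 'a metric) \<Rightarrow> (nat \<Rightarrow> 'a \<Rightarrow> 'a) \<Rightarrow> (nat \<Rightarrow> 'a measure) \<Rightarrow> (nat \<Rightarrow> 'a \<Rightarrow> real) \<Rightarrow> ereal" where
  "metric_pressure X f \<mu> \<phi> =
     metric_entropy X f \<mu> +
     liminf (\<lambda>n. ereal (1 / real n * (\<integral>x. birkhoff_sum f \<phi> n x \<partial>\<mu> 0)))"


definition bowen_dist ::
  "(nat \<Rightarrow> 'a metric) \<Rightarrow> (nat \<Rightarrow> 'a \<Rightarrow> 'a) \<Rightarrow> nat \<Rightarrow> 'a \<Rightarrow> 'a \<Rightarrow> real" where
  "bowen_dist X f n x y = (MAX j\<in>{..n}. mdist (X j) (nds_iter f 0 j x) (nds_iter f 0 j y))"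

definition nds_separated ::
  "(nat \<Rightarrow> 'a metric) \<Rightarrow> (nat \<Rightarrow> 'a \<Rightarrow> 'a) \<Rightarrow> nat \<Rightarrow> real \<Rightarrow> 'a set \<Rightarrow> bool" where
  "nds_separated X f n \<epsilon> E \<longleftrightarrow>
     E \<subseteq> mspace (X 0) \<and> (\<forall>x\<in>E. \<forall>y\<in>E. x \<noteq> y \<longrightarrow> \<epsilon> \<le> bowen_dist X f n x y)"

text \<open>
  For \<open>\<epsilon> > 0\<close> compactness of \<open>X 0\<close> and continuity make every separated set finite,
  so the sum below never takes the default value for infinite index sets.
\<close>

definition sep_sum ::
  "(nat \<Rightarrow> 'a metric) \<Rightarrow> (nat \<Rightarrow> 'a \<Rightarrow> 'a) \<Rightarrow> (nat \<Rightarrow> 'a \<Rightarrow> real) \<Rightarrow> nat \<Rightarrow> real \<Rightarrow> ereal" where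
  "sep_sum X f \<phi> n \<epsilon> =
     (SUP E\<in>{E. nds_separated X f n \<epsilon> E}. ereal (\<Sum>x\<in>E. exp (birkhoff_sum f \<phi> n x)))"

definition ln_ereal :: "ereal \<Rightarrow> ereal" where
  "ln_ereal x = (if x \<le> 0 then -\<infinity> else if x = \<infinity> then \<infinity> else ereal (ln (real_of_ereal x)))"

definition top_pressure ::
  "(nat \<Rightarrow> 'a metric) \<Rightarrow> (nat \<Rightarrow> 'a \<Rightarrow> 'a) \<Rightarrow> (nat \<Rightarrow> 'a \<Rightarrow> real) \<Rightarrow> ereal" where
  "top_pressure X f \<phi> =
     Lim (at_right 0) (\<lambda>\<epsilon>. limsup (\<lambda>n. ereal (1 / real n) * ln_ereal (sep_sum X f \<phi> n \<epsilon>)))"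

end

theory Submission
  imports Defs
begin

text \<open>
  Fix an admissible sequence of partitions \<open>P\<close>, a small radius \<open>r\<close> and a maximal
  \<open>(n, r)\<close>-separated set \<open>E\<close>. By maximality \<open>E\<close> is spanning, so each point of
  \<open>X 0\<close> follows some centre in \<open>E\<close> up to time \<open>n\<close>. Admissibility supplies compact cores
  inside the cells, uniformly far apart, that miss only a small measure. If \<open>r\<close> is at most half
  their distance, then the centre determines which cell a point visits, at every time when the point
  is in a core. By invariance the other times are rare on average, uniformly in time.

  Therefore an itinerary of length \<open>n\<close> costs no more information than the choice of a centre,
  plus a small amount per unit of time for the rare exceptional times: which times they are and which
  of the boundedly many cells is visited then. To include the potential, centres are chosen with
  probability proportional to \<open>exp (S_n \<phi>)\<close>. The Gibbs inequality
  (\<open>partition_entropy_le_integral\<close>), with the weights of a random itinerary that follows the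
  centre up to occasional errors, turns this into the bound
  \<open>H(P^n) + \<integral> S_n \<phi> \<le> ln (\<Sum>e\<in>E. exp (S_n \<phi> e)) + n * \<tau>\<close> with \<open>\<tau>\<close> as small
  as desired (\<open>entropy_plus_integral_le\<close>, \<open>entropy_wrt_le_top_pressure\<close>). The sum on the
  right is one of those whose supremum defines the topological pressure; dividing by \<open>n\<close>,
  passing to upper limits and letting \<open>\<tau>\<close> tend to zero finishes the proof.
\<close>

section \<open>The Gibbs inequality\<close>

text \<open>
  Since \<open>ln t \<le> t - 1\<close>, replacing the weights inside the logarithm of an entropy by any others
  of total mass at most one can only increase it: \<open>-\<Sum> p ln p \<le> -\<Sum> p ln q\<close>. The right
  side is the integral of \<open>-ln q\<close>, read as a function that is constant on cells. Only a
  pointwise lower bound \<open>g\<close> of \<open>ln q\<close> is asked for, because \<open>g\<close> may then vary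
  inside a cell; that is what lets a potential such as a Birkhoff sum enter.
\<close>

lemma partition_entropy_le_integral:
  assumes "prob_space M" "finite Q" "partition_on (space M) Q" "Q \<subseteq> sets M"
    and q_pos: "\<And>A. A \<in> Q \<Longrightarrow> 0 < q A" and q_sum: "sum q Q \<le> 1"
    and g: "integrable M g" "\<And>A x. A \<in> Q \<Longrightarrow> x \<in> A \<Longrightarrow> g x \<le> ln (q A)"
  shows "partition_entropy M Q \<le> - (\<integral>x. g x \<partial>M)"
proof -
  interpret prob_space M by fact
  have union: "\<Union>Q = space M" and disj: "disjoint Q"
    using assms(3) by (auto simp: partition_on_def)
  have p_sum: "(\<Sum>A\<in>Q. prob A) = 1"
  proof -
    have "(\<Sum>A\<in>Q. prob A) = prob (\<Union>Q)"
      using assms(2,4) disj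
      by (subst finite_measure_finite_Union[of Q "\<lambda>A. A", simplified])
         (auto simp: disjoint_family_on_def disjoint_def)
    then show ?thesis using union prob_space by simp
  qed
  have int: "integrable M (\<lambda>x. \<Sum>A\<in>Q. ln (q A) * indicator A x)"
    using assms(4) by (intro Bochner_Integration.integrable_sum integrable_mult_right)
       (auto simp: less_top[symmetric])
  have "(\<integral>x. g x \<partial>M) \<le> (\<integral>x. (\<Sum>A\<in>Q. ln (q A) * indicator A x) \<partial>M)"
  proof (rule integral_mono[OF g(1) int])
    fix x assume "x \<in> space M"
    then obtain A where A: "A \<in> Q" "x \<in> A" using union by blast
    have "(\<Sum>B\<in>Q. ln (q B) * indicator B x) = (\<Sum>B\<in>Q. if B = A then ln (q A) else 0)"
      using A disj by (intro sum.cong) (auto simp: disjoint_def indicator_def)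
    also have "\<dots> = ln (q A)" using A assms(2) by simp
    finally show "g x \<le> (\<Sum>B\<in>Q. ln (q B) * indicator B x)" using g(2)[OF A] by simp
  qed
  also have "\<dots> = (\<Sum>A\<in>Q. prob A * ln (q A))"
    using assms(4)
    by (subst Bochner_Integration.integral_sum)
       (auto simp: less_top[symmetric] mult.commute Int_absorb1 sets.sets_into_space subset_iff
         intro!: sum.cong integrable_mult_left)
  also have "\<dots> \<le> (\<Sum>A\<in>Q. prob A * ln (prob A) + (q A - prob A))"
  proof (rule sum_mono)
    fix A assume A: "A \<in> Q"
    show "prob A * ln (q A) \<le> prob A * ln (prob A) + (q A - prob A)"
    proof (cases "prob A = 0")
      case True
      then show ?thesis using q_pos[OF A] by simp
    next
      case False
      then have p: "prob A > 0" using zero_less_measure_iff by blast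
      have "ln (q A) - ln (prob A) = ln (q A / prob A)"
        using p q_pos[OF A] by (simp add: ln_div)
      also have "\<dots> \<le> q A / prob A - 1"
        using p q_pos[OF A] by (intro ln_le_minus_one) simp
      finally have "prob A * (ln (q A) - ln (prob A)) \<le> prob A * (q A / prob A - 1)"
        using p by (intro mult_left_mono) auto
      then show ?thesis using p by (simp add: algebra_simps)
    qed
  qed
  also have "\<dots> \<le> (\<Sum>A\<in>Q. prob A * ln (prob A))"
    using q_sum p_sum by (simp add: sum.distrib sum_subtractf)
  finally show ?thesis by (simp add: partition_entropy_def)
qed

section \<open>Orbits, measurability and invariance\<close>

lemma nds_iter_continuous_map:
  assumes "nds X f"
  shows "continuous_map (mtopology_of (X 0)) (mtopology_of (X i)) (nds_iter f 0 i)"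
proof (induction i)
  case (Suc i)
  moreover have "continuous_map (mtopology_of (X i)) (mtopology_of (X (Suc i))) (f i)"
    using assms by (simp add: nds_def)
  ultimately have "continuous_map (mtopology_of (X 0)) (mtopology_of (X (Suc i))) (f i \<circ> nds_iter f 0 i)"
    by (rule continuous_map_compose)
  then show ?case by (simp add: comp_def)
qed simp

lemma nds_iter_in_mspace:
  assumes "nds X f" "x \<in> mspace (X 0)"
  shows "nds_iter f 0 i x \<in> mspace (X i)"
  using continuous_map_funspace[OF nds_iter_continuous_map[OF assms(1)]] assms(2)
  by (auto simp: Pi_iff)

lemma continuous_map_metric_borel_measurable:
  assumes "continuous_map (mtopology_of X) (mtopology_of Y) g"
    and "space M = mspace X" "sets M = metric_borel_sets X"
    and "space N = mspace Y" "sets N = metric_borel_sets Y"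
  shows "g \<in> measurable M N"
proof (rule measurable_sigma_sets[OF assms(5)[unfolded metric_borel_sets_def]])
  show "{U. openin (mtopology_of Y) U} \<subseteq> Pow (mspace Y)"
    using openin_subset by fastforce
  show "g \<in> space M \<rightarrow> mspace Y"
    using continuous_map_funspace[OF assms(1)] assms(2) by auto
  fix U assume "U \<in> {U. openin (mtopology_of Y) U}"
  then have "openin (mtopology_of X) {x \<in> mspace X. g x \<in> U}"
    using openin_continuous_map_preimage[OF assms(1)] by simp
  moreover have "{x \<in> mspace X. g x \<in> U} = g -` U \<inter> space M"
    using assms(2) by auto
  ultimately show "g -` U \<inter> space M \<in> sets M"
    using assms(3) by (auto simp: metric_borel_sets_def)
qed

lemma continuous_map_real_metric_borel_measurable:
  assumes "continuous_map (mtopology_of X) euclideanreal g"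
    and "space M = mspace X" "sets M = metric_borel_sets X"
  shows "g \<in> borel_measurable M"
proof (rule borel_measurableI)
  fix U :: "real set" assume "open U"
  then have "openin (mtopology_of X) {x \<in> mspace X. g x \<in> U}"
    using openin_continuous_map_preimage[OF assms(1)] by simp
  moreover have "{x \<in> mspace X. g x \<in> U} = g -` U \<inter> space M"
    using assms(2) by auto
  ultimately show "g -` U \<inter> space M \<in> sets M"
    using assms(3) by (auto simp: metric_borel_sets_def)
qed

lemma compactin_in_metric_borel_sets:
  assumes "compactin (mtopology_of X) C"
  shows "C \<in> metric_borel_sets X"
proof -
  have "Hausdorff_space (mtopology_of X)"
    by (simp add: Metric_space.Hausdorff_space_mtopology mtopology_of_def)
  then have "closedin (mtopology_of X) C"
    using assms compactin_imp_closedin by blast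
  then have "C = mspace X - (mspace X - C)" "openin (mtopology_of X) (mspace X - C)"
    by (auto simp: closedin_def)
  then show ?thesis
    unfolding metric_borel_sets_def
    by (metis mem_Collect_eq sigma_sets.Basic sigma_sets.Compl)
qed

lemma unif_equicontinuous_imp_continuous_map:
  assumes "unif_equicontinuous X \<phi>"
  shows "continuous_map (mtopology_of (X i)) euclideanreal (\<phi> i)"
proof -
  interpret M: Metric_space "mspace (X i)" "mdist (X i)" by simp
  have "continuous_map M.mtopology Met_TC.mtopology (\<phi> i)"
    unfolding Metric_space.metric_continuous_map[OF M.Metric_space_axioms Met_TC.Metric_space_axioms]
  proof (intro conjI ballI allI impI)
    fix a :: 'a and \<epsilon> :: real assume "a \<in> mspace (X i)" "0 < \<epsilon>"
    then show "\<exists>\<delta>>0. \<forall>x. x \<in> mspace (X i) \<and> mdist (X i) a x < \<delta> \<longrightarrow> dist (\<phi> i a) (\<phi> i x) < \<epsilon>"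
      using assms unfolding unif_equicontinuous_def dist_real_def by meson
  qed simp
  then show ?thesis by (simp add: mtopology_of_def)
qed

lemma nds_iter_measurable:
  assumes "nds X f" "ims X f \<mu>"
  shows "nds_iter f 0 i \<in> measurable (\<mu> 0) (\<mu> i)"
  using assms nds_iter_continuous_map[OF assms(1)]
  by (intro continuous_map_metric_borel_measurable[of "X 0" "X i"]) (auto simp: ims_def)

text \<open>
  Invariance turns the time spent in a set at time \<open>i\<close>, averaged over initial points, into
  the \<open>\<mu> i\<close>-measure of that set.
\<close>

lemma distr_nds_iter:
  assumes "nds X f" "ims X f \<mu>"
  shows "distr (\<mu> 0) (\<mu> i) (nds_iter f 0 i) = \<mu> i"
proof (induction i)
  case 0
  then show ?case by (simp add: id_def)
next
  case (Suc i)
  have f: "f i \<in> measurable (\<mu> i) (\<mu> (Suc i))"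
    using assms by (intro continuous_map_metric_borel_measurable[of "X i" "X (Suc i)"])
      (auto simp: ims_def nds_def)
  have "\<mu> (Suc i) = distr (\<mu> i) (\<mu> (Suc i)) (f i)" using assms by (simp add: ims_def)
  also have "\<dots> = distr (distr (\<mu> 0) (\<mu> i) (nds_iter f 0 i)) (\<mu> (Suc i)) (f i)"
    using Suc by simp
  also have "\<dots> = distr (\<mu> 0) (\<mu> (Suc i)) (f i \<circ> nds_iter f 0 i)"
    by (rule distr_distr[OF f nds_iter_measurable[OF assms]])
  finally show ?case by (simp add: comp_def)
qed

lemma integrable_birkhoff_sum:
  assumes "nds X f" "ims X f \<mu>" "unif_equicontinuous X \<phi>" "unif_bounded X \<phi>"
  shows "integrable (\<mu> 0) (birkhoff_sum f \<phi> n)"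
proof -
  interpret prob_space "\<mu> 0" using assms(2) by (simp add: ims_def)
  obtain C where C: "\<And>i x. x \<in> mspace (X i) \<Longrightarrow> \<bar>\<phi> i x\<bar> \<le> C"
    using assms(4) by (auto simp: unif_bounded_def)
  have sp: "space (\<mu> 0) = mspace (X 0)" using assms(2) by (simp add: ims_def)
  have "integrable (\<mu> 0) (\<lambda>x. \<phi> i (nds_iter f 0 i x))" for i
  proof (rule integrable_const_bound[of _ C])
    show "AE x in \<mu> 0. norm (\<phi> i (nds_iter f 0 i x)) \<le> C"
      using C nds_iter_in_mspace[OF assms(1)] sp by (intro AE_I2) auto
    have "\<phi> i \<in> borel_measurable (\<mu> i)"
      using assms(2) unif_equicontinuous_imp_continuous_map[OF assms(3)]
      by (intro continuous_map_real_metric_borel_measurable[of "X i"]) (auto simp: ims_def)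
    then show "(\<lambda>x. \<phi> i (nds_iter f 0 i x)) \<in> borel_measurable (\<mu> 0)"
      by (rule measurable_compose[OF nds_iter_measurable[OF assms(1,2)]])
  qed
  then show ?thesis unfolding birkhoff_sum_def[abs_def] by simp
qed

section \<open>Separated sets that span\<close>

lemma bowen_dist_less_iff:
  "bowen_dist X f n x y < r \<longleftrightarrow>
    (\<forall>j\<le>n. mdist (X j) (nds_iter f 0 j x) (nds_iter f 0 j y) < r)"
  unfolding bowen_dist_def by (subst Max_less_iff) auto

lemma bowen_dist_commute: "bowen_dist X f n x y = bowen_dist X f n y x"
  by (simp add: bowen_dist_def mdist_commute)

lemma bowen_dist_self_less:
  assumes "nds X f" "x \<in> mspace (X 0)" "0 < r"
  shows "bowen_dist X f n x x < r"
  using assms nds_iter_in_mspace[OF assms(1,2)]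
  by (simp add: bowen_dist_less_iff Metric_space.mdist_zero[OF Metric_space_mspace_mdist])

text \<open>
  A separated set of largest cardinality spans, for a point left out could be added to it. The
  cardinalities are bounded because compactness covers \<open>X 0\<close> by finitely many Bowen balls of
  half the radius, and each of these holds at most one point of a separated set.
\<close>

lemma exists_separated_spanning_set:
  assumes "nds X f" "0 < r"
  obtains E where "finite E" "nds_separated X f n r E"
    "\<And>x. x \<in> mspace (X 0) \<Longrightarrow> \<exists>e\<in>E. bowen_dist X f n e x < r"
proof -
  define d where "d = r / 2"
  have d: "0 < d" "d + d = r" using assms by (auto simp: d_def)
  define B where "B x = {y \<in> mspace (X 0). bowen_dist X f n x y < d}" for x
  have op: "openin (mtopology_of (X 0)) (B x)" if x: "x \<in> mspace (X 0)" for x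
  proof -
    have "openin (mtopology_of (X j)) (mball_of (X j) (nds_iter f 0 j x) d)" for j
      by (simp add: Metric_space.openin_mball mball_of_def mtopology_of_def)
    then have "openin (mtopology_of (X 0))
       {y \<in> mspace (X 0). nds_iter f 0 j y \<in> mball_of (X j) (nds_iter f 0 j x) d}" for j
      using openin_continuous_map_preimage[OF nds_iter_continuous_map[OF assms(1)]] by fastforce
    then have "openin (mtopology_of (X 0)) (\<Inter>j\<in>{..n}.
       {y \<in> mspace (X 0). nds_iter f 0 j y \<in> mball_of (X j) (nds_iter f 0 j x) d})"
      by (intro openin_Inter) auto
    also have "(\<Inter>j\<in>{..n}.
       {y \<in> mspace (X 0). nds_iter f 0 j y \<in> mball_of (X j) (nds_iter f 0 j x) d}) = B x"
      using nds_iter_in_mspace[OF assms(1)] x by (auto simp: B_def bowen_dist_less_iff)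
    finally show ?thesis .
  qed
  have cover: "mspace (X 0) \<subseteq> \<Union>(B ` mspace (X 0))"
  proof
    fix x assume "x \<in> mspace (X 0)"
    then have "x \<in> B x"
      using bowen_dist_self_less[OF assms(1) _ d(1)] by (simp add: B_def)
    then show "x \<in> \<Union>(B ` mspace (X 0))" using \<open>x \<in> mspace (X 0)\<close> by blast
  qed
  have "compactin (mtopology_of (X 0)) (mspace (X 0))"
    using assms(1) by (simp add: nds_def compact_space_def)
  moreover have "\<forall>U\<in>B ` mspace (X 0). openin (mtopology_of (X 0)) U" using op by blast
  ultimately obtain \<F> where "finite \<F>" "\<F> \<subseteq> B ` mspace (X 0)" "mspace (X 0) \<subseteq> \<Union>\<F>"
    using cover unfolding compactin_def by blast
  then obtain C where C: "C \<subseteq> mspace (X 0)" "finite C" "mspace (X 0) \<subseteq> \<Union>(B ` C)"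
    using finite_subset_image[of \<F> B "mspace (X 0)"] by blast
  have bound: "card E \<le> card C" if E: "nds_separated X f n r E" for E
  proof -
    have "\<exists>c\<in>C. bowen_dist X f n c e < d" if "e \<in> E" for e
    proof -
      have "e \<in> mspace (X 0)" using E that by (auto simp: nds_separated_def)
      then obtain c where "c \<in> C" "e \<in> B c" using C(3) by blast
      then show ?thesis by (auto simp: B_def)
    qed
    then obtain c where c: "\<And>e. e \<in> E \<Longrightarrow> c e \<in> C \<and> bowen_dist X f n (c e) e < d"
      by metis
    have "inj_on c E"
    proof (rule inj_onI, rule ccontr)
      fix x y assume xy: "x \<in> E" "y \<in> E" "c x = c y" "x \<noteq> y"
      have "bowen_dist X f n x y < r"
        unfolding bowen_dist_less_iff
      proof (intro allI impI)
        fix j assume "j \<le> n"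
        interpret M: Metric_space "mspace (X j)" "mdist (X j)" by simp
        have "mdist (X j) (nds_iter f 0 j (c x)) (nds_iter f 0 j x) < d"
             "mdist (X j) (nds_iter f 0 j (c x)) (nds_iter f 0 j y) < d"
          using c[OF xy(1)] c[OF xy(2)] xy(3) \<open>j \<le> n\<close> by (auto simp: bowen_dist_less_iff)
        moreover have "x \<in> mspace (X 0)" "y \<in> mspace (X 0)" "c x \<in> mspace (X 0)"
          using c[OF xy(1)] C(1) xy(1,2) E by (auto simp: nds_separated_def)
        then have "mdist (X j) (nds_iter f 0 j x) (nds_iter f 0 j y)
          \<le> mdist (X j) (nds_iter f 0 j (c x)) (nds_iter f 0 j x)
            + mdist (X j) (nds_iter f 0 j (c x)) (nds_iter f 0 j y)"
          using nds_iter_in_mspace[OF assms(1)] by (intro M.triangle'')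
        ultimately show "mdist (X j) (nds_iter f 0 j x) (nds_iter f 0 j y) < r"
          using d(2) by linarith
      qed
      moreover have "r \<le> bowen_dist X f n x y" using xy E by (simp add: nds_separated_def)
      ultimately show False by simp
    qed
    then show ?thesis using c C(2) by (intro card_inj_on_le) auto
  qed
  define S where "S = {E. finite E \<and> nds_separated X f n r E}"
  have "{} \<in> S" by (auto simp: S_def nds_separated_def)
  moreover have "\<And>E. E \<in> S \<Longrightarrow> card E \<le> card C" using bound by (auto simp: S_def)
  ultimately obtain E where E: "E \<in> S" "\<And>E'. E' \<in> S \<Longrightarrow> card E' \<le> card E"
    using ex_has_greatest_nat[of "\<lambda>E. E \<in> S" "{}" card "Suc (card C)"] by (auto simp: less_Suc_eq_le)
  show ?thesis
  proof
    show "finite E" "nds_separated X f n r E" using E by (auto simp: S_def)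
    fix x assume x: "x \<in> mspace (X 0)"
    show "\<exists>e\<in>E. bowen_dist X f n e x < r"
    proof (rule ccontr)
      assume "\<not> ?thesis"
      then have far: "r \<le> bowen_dist X f n e x" if "e \<in> E" for e using that by force
      have "r \<le> bowen_dist X f n x e" if "e \<in> E" for e
        using far[OF that] by (subst bowen_dist_commute)
      then have "insert x E \<in> S"
        using E(1) x far by (auto simp: S_def nds_separated_def)
      moreover have "x \<notin> E"
        using far[of x] bowen_dist_self_less[OF assms(1) x assms(2), of n] by linarith
      ultimately show False using E(2)[of "insert x E"] E(1) by (simp add: S_def)
    qed
  qed
qed

section \<open>Cells of the joined partition\<close>

lemma preimage_partition_on:
  assumes "nds X f" "partition_on (mspace (X i)) P"
  shows "partition_on (mspace (X 0)) (preimage_partition X f i P)"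
proof -
  let ?F = "\<lambda>A. nds_iter f 0 i -` A \<inter> mspace (X 0)"
  have "partition_on (?F (mspace (X i))) (?F ` P - {{}})"
    by (rule partition_on_transform[OF assms(2)]) (auto simp: disjnt_def)
  moreover have "?F (mspace (X i)) = mspace (X 0)"
    using nds_iter_in_mspace[OF assms(1)] by auto
  ultimately show ?thesis by (simp add: preimage_partition_def)
qed

lemma partition_on_nds_join:
  assumes "nds X f" "\<And>i. partition_on (mspace (X i)) (P i)" "0 < n"
  shows "partition_on (mspace (X 0)) (nds_join X f P n)"
  unfolding nds_join_def using preimage_partition_on[OF assms(1,2)] assms(3)
  by (intro partition_on_common_refinement) auto

text \<open>
  A cell of the join is described by its itinerary \<open>L\<close>, which lists the cell visited at each time.
  This makes sums over the join comparable with sums over a product of the \<open>P i\<close>, which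
  factorise.
\<close>

lemma nds_join_cell:
  assumes "A \<in> nds_join X f P n" "0 < n"
  obtains L where "L \<in> (\<Pi>\<^sub>E i\<in>{..<n}. P i)"
    "A = (\<Inter>i\<in>{..<n}. nds_iter f 0 i -` L i \<inter> mspace (X 0))"
proof -
  let ?pp = "\<lambda>i. preimage_partition X f i (P i)"
  obtain F where F: "\<And>i. i < n \<Longrightarrow> F (?pp i) \<in> ?pp i" and A: "A = \<Inter>(F ` ?pp ` {..<n})"
    using assms(1) by (auto simp: nds_join_def common_refinement_def PiE_iff)
  have "\<exists>B\<in>P i. F (?pp i) = nds_iter f 0 i -` B \<inter> mspace (X 0)" if "i < n" for i
    using F[OF that] by (auto simp: preimage_partition_def)
  then obtain L where L: "\<And>i. i < n \<Longrightarrow> L i \<in> P i"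
      "\<And>i. i < n \<Longrightarrow> F (?pp i) = nds_iter f 0 i -` L i \<inter> mspace (X 0)"
    by metis
  show ?thesis
  proof
    show "restrict L {..<n} \<in> (\<Pi>\<^sub>E i\<in>{..<n}. P i)" using L(1) by auto
    show "A = (\<Inter>i\<in>{..<n}. nds_iter f 0 i -` restrict L {..<n} i \<inter> mspace (X 0))"
      using L(2) A by auto
  qed
qed

section \<open>Entropy against a spanning set\<close>

text \<open>
  The finite-time estimate. Call time \<open>i\<close> bad for \<open>x\<close> if the orbit of \<open>x\<close> is
  then outside all the compact cores \<open>K i A\<close>. Fix a centre \<open>e\<close> in \<open>E\<close>. Points in
  the Bowen ball about \<open>e\<close> stay at mutual distance less than \<open>2 * r\<close>, while different
  cores are at least that far apart; hence all those points for which \<open>i\<close> is a good time visit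
  the same cell, \<open>a i e\<close>. So the itinerary of a point is known from its centre except at
  bad times, which have frequency at most \<open>N * \<kappa>\<close> on average.

  The weights for the Gibbs inequality encode this as a random itinerary: draw a centre with
  probability proportional to \<open>exp (\<psi> e)\<close>, then follow \<open>a i e\<close> with probability
  \<open>1 - \<eta>\<close> and a uniformly chosen cell with probability \<open>\<eta>\<close>, independently at each
  time. The itinerary of \<open>x\<close> has probability at least that of drawing the centre near
  \<open>x\<close> times a factor \<open>1 - \<eta>\<close> for each good time and \<open>\<eta> / N\<close> for each bad
  one. Taking logarithms and integrating gives the inequality.
\<close>

lemma entropy_plus_integral_le:
  fixes X :: "nat \<Rightarrow> 'a metric" and \<psi> :: "'a \<Rightarrow> real"
  assumes nds: "nds X f" and ims: "ims X f \<mu>"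
    and P: "\<And>i. finite_borel_partition (X i) (P i)" "\<And>i. card (P i) \<le> N"
    and K: "\<And>i A. A \<in> P i \<Longrightarrow> K i A \<subseteq> A" "\<And>i A. A \<in> P i \<Longrightarrow> compactin (mtopology_of (X i)) (K i A)"
      "\<And>i A. A \<in> P i \<Longrightarrow> measure (\<mu> i) (A - K i A) \<le> \<kappa>"
      "\<And>i A B x y. A \<in> P i \<Longrightarrow> B \<in> P i \<Longrightarrow> A \<noteq> B \<Longrightarrow> x \<in> K i A \<Longrightarrow> y \<in> K i B \<Longrightarrow> 2 * r \<le> mdist (X i) x y"
    and E: "finite E" "E \<subseteq> mspace (X 0)" "\<And>x. x \<in> mspace (X 0) \<Longrightarrow> \<exists>e\<in>E. bowen_dist X f n e x < r"
    and \<psi>: "integrable (\<mu> 0) \<psi>"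
      "\<And>e x. e \<in> E \<Longrightarrow> x \<in> mspace (X 0) \<Longrightarrow> bowen_dist X f n e x < r \<Longrightarrow> \<psi> x \<le> \<psi> e + c"
    and \<eta>: "0 < \<eta>" "\<eta> < 1" and n: "0 < n"
  shows "partition_entropy (\<mu> 0) (nds_join X f P n) + (\<integral>x. \<psi> x \<partial>\<mu> 0)
    \<le> ln (\<Sum>e\<in>E. exp (\<psi> e)) + c + real n * (real N * \<kappa> * ln (real N / \<eta>) - ln (1 - \<eta>))"
proof -
  interpret prob_space "\<mu> 0" using ims by (simp add: ims_def)
  let ?T = "nds_iter f 0" and ?Q = "nds_join X f P n"
  have sp: "space (\<mu> i) = mspace (X i)" "sets (\<mu> i) = metric_borel_sets (X i)" for i
    using ims by (auto simp: ims_def)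
  have Pp: "partition_on (mspace (X i)) (P i)" "finite (P i)" "P i \<subseteq> sets (\<mu> i)" for i
    using P(1)[of i] sp by (auto simp: finite_borel_partition_def)
  have T_in: "?T i x \<in> mspace (X i)" if "x \<in> mspace (X 0)" for i x
    by (rule nds_iter_in_mspace[OF nds that])
  have T_meas: "?T i \<in> measurable (\<mu> 0) (\<mu> i)" for i
    by (rule nds_iter_measurable[OF nds ims])
  have P_ne: "P i \<noteq> {}" for i
  proof -
    obtain x where "x \<in> mspace (X 0)" using not_empty sp by blast
    then show ?thesis using Pp(1)[of i] T_in[of x i] by (auto simp: partition_on_def)
  qed
  have N: "1 \<le> N" using P(2)[of 0] Pp(2)[of 0] P_ne[of 0]
    by (metis card_gt_0_iff le_trans less_eq_Suc_le One_nat_def)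
  have E_ne: "E \<noteq> {}" using E(3) not_empty sp by blast

  define Z where "Z = (\<Sum>e\<in>E. exp (\<psi> e))"
  have Z: "0 < Z" unfolding Z_def using E(1) E_ne by (intro sum_pos) auto
  \<comment> \<open>The cell whose core is visited from the Bowen ball about \<open>e\<close> at time \<open>i\<close>. If no core
    is visited, \<open>a i e\<close> is arbitrary: every point near \<open>e\<close> is then bad at time \<open>i\<close>.\<close>
  define a where "a i e = (SOME A. A \<in> P i \<and>
    (\<exists>x\<in>mspace (X 0). bowen_dist X f n e x < r \<and> ?T i x \<in> K i A))" for i e
  have a_eq: "a i e = A"
    if "A \<in> P i" "x \<in> mspace (X 0)" "bowen_dist X f n e x < r" "?T i x \<in> K i A" "e \<in> E" "i < n" for A i e x
  proof (rule ccontr)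
    assume ne: "a i e \<noteq> A"
    have "a i e \<in> P i \<and> (\<exists>y\<in>mspace (X 0). bowen_dist X f n e y < r \<and> ?T i y \<in> K i (a i e))"
      unfolding a_def by (rule someI[of _ A]) (use that in blast)
    then obtain y where y: "a i e \<in> P i" "y \<in> mspace (X 0)" "bowen_dist X f n e y < r" "?T i y \<in> K i (a i e)"
      by blast
    interpret M: Metric_space "mspace (X i)" "mdist (X i)" by simp
    have "mdist (X i) (?T i e) (?T i x) < r" "mdist (X i) (?T i e) (?T i y) < r"
      using that(3,6) y(3) by (auto simp: bowen_dist_less_iff)
    then have "mdist (X i) (?T i y) (?T i x) < 2 * r"
      using M.triangle''[of "?T i y" "?T i e" "?T i x"] T_in[of x i] T_in[of y i] T_in[of e i] that(2,5) y(2) E(2)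
      by (smt (verit) M.commute M.triangle subsetD)
    then show False using K(4)[OF y(1) that(1) ne y(4) that(4)] by simp
  qed

  \<comment> \<open>The probability of the itinerary \<open>L\<close> in the random model. The total mass may fall short
    of one, since the uniform step has mass \<open>\<eta> * card (P i) / N\<close> and an arbitrary \<open>a i e\<close> may
    lie outside \<open>P i\<close>.\<close>
  define w where "w L =
    (\<Sum>e\<in>E. exp (\<psi> e) / Z * (\<Prod>i<n. \<eta> / N + (1 - \<eta>) * of_bool (L i = a i e)))" for L
  have w_pos: "0 < w L" for L
    unfolding w_def using E(1) E_ne Z \<eta> N
    by (intro sum_pos mult_pos_pos prod_pos) (auto intro!: add_pos_nonneg)
  have w_sum: "(\<Sum>L\<in>(\<Pi>\<^sub>E i\<in>{..<n}. P i). w L) \<le> 1"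
  proof -
    have one: "(\<Sum>A\<in>P i. \<eta> / N + (1 - \<eta>) * of_bool (A = a i e)) \<le> 1" for i e
    proof -
      have "(\<Sum>A\<in>P i. \<eta> / N + (1 - \<eta>) * of_bool (A = a i e))
          = card (P i) * (\<eta> / N) + (1 - \<eta>) * (\<Sum>A\<in>P i. of_bool (A = a i e))"
        by (simp add: sum.distrib sum_distrib_left)
      also have "card (P i) * (\<eta> / N) \<le> N * (\<eta> / N)"
        using P(2)[of i] \<eta> by (intro mult_right_mono) auto
      also have "N * (\<eta> / N) = \<eta>" using N by simp
      also have "(\<Sum>A\<in>P i. of_bool (A = a i e)) \<le> (1::real)"
        using Pp(2)[of i] by (simp add: of_bool_def)
      finally show ?thesis using \<eta> by simp
    qed
    \<comment> \<open>For a fixed centre the steps are independent, so the sum over itineraries is a product.\<close>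
    have "(\<Sum>L\<in>(\<Pi>\<^sub>E i\<in>{..<n}. P i). w L)
        = (\<Sum>e\<in>E. exp (\<psi> e) / Z *
            (\<Sum>L\<in>(\<Pi>\<^sub>E i\<in>{..<n}. P i). \<Prod>i<n. \<eta> / N + (1 - \<eta>) * of_bool (L i = a i e)))"
      unfolding w_def by (subst sum.swap) (simp add: sum_distrib_left)
    also have "\<dots> = (\<Sum>e\<in>E. exp (\<psi> e) / Z * (\<Prod>i<n. \<Sum>A\<in>P i. \<eta> / N + (1 - \<eta>) * of_bool (A = a i e)))"
      using Pp(2) by (subst prod_sum_PiE) auto
    also have "\<dots> \<le> (\<Sum>e\<in>E. exp (\<psi> e) / Z * 1)"
    proof (intro sum_mono mult_left_mono prod_le_1)
      fix e i show "0 \<le> (\<Sum>A\<in>P i. \<eta> / N + (1 - \<eta>) * of_bool (A = a i e)) \<and>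
          (\<Sum>A\<in>P i. \<eta> / N + (1 - \<eta>) * of_bool (A = a i e)) \<le> 1"
        using one \<eta> by (auto intro!: sum_nonneg)
    qed (use Z in auto)
    also have "\<dots> = 1" using Z by (simp add: Z_def flip: sum_divide_distrib)
    finally show ?thesis .
  qed

  define cell where "cell L = (\<Inter>i\<in>{..<n}. ?T i -` L i \<inter> mspace (X 0))" for L
  have "\<exists>L. L \<in> (\<Pi>\<^sub>E i\<in>{..<n}. P i) \<and> A = cell L" if "A \<in> ?Q" for A
    using nds_join_cell[OF that n] unfolding cell_def by metis
  then obtain lab where lab: "\<And>A. A \<in> ?Q \<Longrightarrow> lab A \<in> (\<Pi>\<^sub>E i\<in>{..<n}. P i)"
      "\<And>A. A \<in> ?Q \<Longrightarrow> A = cell (lab A)"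
    by metis
  have lab_inj: "inj_on lab ?Q" by (rule inj_onI) (metis lab(2))
  have fin_PiE: "finite (\<Pi>\<^sub>E i\<in>{..<n}. P i)" using Pp(2) by (intro finite_PiE) auto
  have Q_fin: "finite ?Q"
    using lab(1) by (intro inj_on_finite[OF lab_inj _ fin_PiE]) auto
  have Q_sets: "?Q \<subseteq> sets (\<mu> 0)"
  proof
    fix A assume A: "A \<in> ?Q"
    have "?T i -` lab A i \<inter> mspace (X 0) \<in> sets (\<mu> 0)" if "i < n" for i
      using measurable_sets[OF T_meas, of "lab A i" i] lab(1)[OF A] Pp(3)[of i] that sp
      by (auto simp: PiE_iff)
    then have "cell (lab A) \<in> sets (\<mu> 0)"
      unfolding cell_def using n by (intro sets.finite_INT) auto
    then show "A \<in> sets (\<mu> 0)" using lab(2)[OF A] by simp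
  qed
  have Q_part: "partition_on (space (\<mu> 0)) ?Q"
    using partition_on_nds_join[OF nds Pp(1) n] sp by simp

  define bad where "bad i = mspace (X i) - (\<Union>A\<in>P i. K i A)" for i
  have bad_sets: "bad i \<in> sets (\<mu> i)" for i
    unfolding bad_def using K(2) compactin_in_metric_borel_sets Pp(2) sp
    by (metis (no_types, lifting) sets.Diff sets.finite_UN sets.top)
  have bad_measure: "measure (\<mu> i) (bad i) \<le> real N * \<kappa>" for i
  proof -
    interpret Mi: prob_space "\<mu> i" using ims by (simp add: ims_def)
    have K_sets: "A - K i A \<in> sets (\<mu> i)" if "A \<in> P i" for A
      using that K(2) compactin_in_metric_borel_sets Pp(3)[of i] sp by blast
    have "bad i \<subseteq> (\<Union>A\<in>P i. A - K i A)"
      unfolding bad_def partition_onD1[OF Pp(1)[of i]] by blast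
    then have "measure (\<mu> i) (bad i) \<le> measure (\<mu> i) (\<Union>A\<in>P i. A - K i A)"
      using K_sets Pp(2)[of i] by (intro Mi.finite_measure_mono) auto
    also have "\<dots> \<le> (\<Sum>A\<in>P i. measure (\<mu> i) (A - K i A))"
      using K_sets Pp(2)[of i] by (intro Mi.finite_measure_subadditive_finite) auto
    also have "\<dots> \<le> (\<Sum>A\<in>P i. \<kappa>)" using K(3) by (intro sum_mono) auto
    also have "\<dots> = real (card (P i)) * \<kappa>" by simp
    also have "\<dots> \<le> real N * \<kappa>"
    proof (rule mult_right_mono)
      obtain A where "A \<in> P i" using P_ne[of i] by blast
      then show "0 \<le> \<kappa>" using K(3) measure_nonneg order_trans by metis
    qed (use P(2) in simp)
    finally show ?thesis .
  qed
  have bad_int: "integrable (\<mu> 0) (\<lambda>x. indicator (bad i) (?T i x) :: real)"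
    and bad_integral: "(\<integral>x. indicator (bad i) (?T i x) \<partial>\<mu> 0) = measure (\<mu> i) (bad i)" for i
  proof -
    interpret Mi: prob_space "\<mu> i" using ims by (simp add: ims_def)
    have "integrable (\<mu> i) (indicator (bad i) :: _ \<Rightarrow> real)"
      using bad_sets[of i] by (simp add: less_top[symmetric])
    then have "integrable (distr (\<mu> 0) (\<mu> i) (?T i)) (indicator (bad i) :: _ \<Rightarrow> real)"
      using distr_nds_iter[OF nds ims] by simp
    then show "integrable (\<mu> 0) (\<lambda>x. indicator (bad i) (?T i x) :: real)"
      by (rule integrable_distr[OF T_meas])
    have "(\<integral>x. (indicator (bad i) (?T i x) :: real) \<partial>\<mu> 0) = (\<integral>x. indicator (bad i) x \<partial>distr (\<mu> 0) (\<mu> i) (?T i))"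
      using bad_sets[of i]
      by (intro integral_distr[OF T_meas, of "indicator (bad i)", symmetric]) simp
    also have "\<dots> = measure (\<mu> i) (bad i)"
      using distr_nds_iter[OF nds ims, of i] bad_sets[of i] sets.sets_into_space[OF bad_sets[of i]]
      by (simp add: Int_absorb2)
    finally show "(\<integral>x. indicator (bad i) (?T i x) \<partial>\<mu> 0) = measure (\<mu> i) (bad i)" .
  qed

  \<comment> \<open>At a bad time the factor \<open>(1 - \<eta>) * \<eta> / N\<close> is used instead of \<open>\<eta> / N\<close>; then
    good and bad times share the term \<open>ln (1 - \<eta>)\<close>.\<close>
  define g where "g x = \<psi> x - c - ln Z + (\<Sum>i<n. ln (1 - \<eta>) - indicator (bad i) (?T i x) * ln (N / \<eta>))" for x
  have g_int: "integrable (\<mu> 0) g"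
    unfolding g_def using \<psi>(1) bad_int by auto
  have g_le: "g x \<le> ln (w (lab A))" if A: "A \<in> ?Q" and "x \<in> A" for A x
  proof -
    have "x \<in> cell (lab A)" using lab(2)[OF A] that(2) by simp
    then have "\<forall>i\<in>{..<n}. x \<in> ?T i -` lab A i \<inter> mspace (X 0)" unfolding cell_def INT_iff .
    then have x: "x \<in> mspace (X 0)" "\<And>i. i < n \<Longrightarrow> ?T i x \<in> lab A i"
      using n by auto
    have labP: "lab A i \<in> P i" if "i < n" for i using lab(1)[OF A] that by (auto simp: PiE_iff)
    obtain e where e: "e \<in> E" "bowen_dist X f n e x < r" using E(3)[OF x(1)] by blast
    have "exp (ln (1 - \<eta>) - indicator (bad i) (?T i x) * ln (N / \<eta>))
        \<le> \<eta> / N + (1 - \<eta>) * of_bool (lab A i = a i e)" if i: "i < n" for i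
    proof (cases "?T i x \<in> bad i")
      case True
      have "exp (ln (1 - \<eta>) - ln (N / \<eta>)) = (1 - \<eta>) * (\<eta> / N)"
        using \<eta> N by (simp add: exp_diff)
      also have "\<dots> \<le> 1 * (\<eta> / N)" using \<eta> by (intro mult_right_mono) auto
      also have "\<dots> \<le> \<eta> / N + (1 - \<eta>) * of_bool (lab A i = a i e)" using \<eta> by simp
      finally show ?thesis using True by simp
    next
      case False
      then obtain B where B: "B \<in> P i" "?T i x \<in> K i B" using T_in[OF x(1)] by (auto simp: bad_def)
      have "B = lab A i"
        using B K(1)[OF B(1)] labP[OF i] x(2)[OF i] partition_onD2[OF Pp(1)[of i]]
        unfolding disjoint_def by blast
      then have "a i e = lab A i" using a_eq[OF B(1) x(1) e(2) B(2) e(1) i] by simp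
      then show ?thesis using False \<eta> by simp
    qed
    then have "(\<Prod>i<n. exp (ln (1 - \<eta>) - indicator (bad i) (?T i x) * ln (N / \<eta>)))
        \<le> (\<Prod>i<n. \<eta> / N + (1 - \<eta>) * of_bool (lab A i = a i e))"
      by (intro prod_mono) auto
    moreover have "exp (\<psi> x - c - ln Z) \<le> exp (\<psi> e) / Z"
    proof -
      have "exp (\<psi> x - c - ln Z) \<le> exp (\<psi> e - ln Z)" using \<psi>(2)[OF e(1) x(1) e(2)] by simp
      also have "\<dots> = exp (\<psi> e) / Z" using Z by (simp add: exp_diff)
      finally show ?thesis .
    qed
    ultimately have "exp (g x) \<le> exp (\<psi> e) / Z * (\<Prod>i<n. \<eta> / N + (1 - \<eta>) * of_bool (lab A i = a i e))"
      unfolding g_def exp_add exp_sum[OF finite_lessThan] using Z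
      by (intro mult_mono) (auto intro: prod_nonneg)
    also have "\<dots> \<le> w (lab A)"
      unfolding w_def using E(1) e(1) Z \<eta>
      by (intro member_le_sum) (auto intro!: divide_nonneg_pos mult_nonneg_nonneg prod_nonneg)
    finally show ?thesis using w_pos by (simp add: ln_ge_iff)
  qed
  have "(\<Sum>A\<in>?Q. w (lab A)) = (\<Sum>L\<in>lab ` ?Q. w L)"
    using lab_inj by (simp add: sum.reindex)
  also have "\<dots> \<le> (\<Sum>L\<in>(\<Pi>\<^sub>E i\<in>{..<n}. P i). w L)"
    using fin_PiE lab(1) w_pos by (intro sum_mono2) (auto intro: less_imp_le)
  finally have "(\<Sum>A\<in>?Q. w (lab A)) \<le> 1" using w_sum by simp
  then have "partition_entropy (\<mu> 0) ?Q \<le> - (\<integral>x. g x \<partial>\<mu> 0)"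
    using partition_entropy_le_integral[OF prob_space_axioms Q_fin Q_part Q_sets, of "\<lambda>A. w (lab A)" g]
      w_pos g_int g_le by blast
  moreover have "(\<integral>x. g x \<partial>\<mu> 0) = (\<integral>x. \<psi> x \<partial>\<mu> 0) - c - ln Z
      + (\<Sum>i<n. ln (1 - \<eta>) - measure (\<mu> i) (bad i) * ln (N / \<eta>))"
    unfolding g_def using \<psi>(1) bad_int by (simp add: bad_integral prob_space)
  moreover have "(\<Sum>i<n. ln (1 - \<eta>) - real N * \<kappa> * ln (N / \<eta>))
      \<le> (\<Sum>i<n. ln (1 - \<eta>) - measure (\<mu> i) (bad i) * ln (N / \<eta>))"
    using \<eta> N bad_measure by (intro sum_mono diff_left_mono mult_right_mono)
       (auto intro!: ln_ge_zero simp: field_simps)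
  ultimately show ?thesis by (simp add: Z_def algebra_simps)
qed

section \<open>Topological pressure as a supremum over scales\<close>

lemma ln_ereal_mono: "x \<le> y \<Longrightarrow> ln_ereal x \<le> ln_ereal y"
  by (cases x; cases y) (auto simp: ln_ereal_def zero_ereal_def)

lemma sep_sum_antimono:
  assumes "r \<le> s"
  shows "sep_sum X f \<phi> n s \<le> sep_sum X f \<phi> n r"
  unfolding sep_sum_def using assms
  by (intro SUP_subset_mono) (fastforce simp: nds_separated_def)+

text \<open>
  A smaller scale admits more separated sets, so the growth rate is monotone in the scale and its
  limit at zero is the supremum over all scales.
\<close>

lemma limsup_sep_sum_le_top_pressure:
  assumes "0 < r"
  shows "limsup (\<lambda>n. ereal (1 / real n) * ln_ereal (sep_sum X f \<phi> n r)) \<le> top_pressure X f \<phi>"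
proof -
  define G where "G r = limsup (\<lambda>n. ereal (1 / real n) * ln_ereal (sep_sum X f \<phi> n r))" for r
  have anti: "G s \<le> G r" if "r \<le> s" for r s
    unfolding G_def using that
    by (intro Limsup_mono always_eventually allI ereal_mult_left_mono ln_ereal_mono sep_sum_antimono) auto
  have "(G \<longlongrightarrow> (SUP s\<in>{0<..}. G s)) (at_right 0)"
  proof (rule increasing_tendsto)
    show "\<forall>\<^sub>F s in at_right 0. G s \<le> (SUP s\<in>{0<..}. G s)"
      using eventually_at_right_less by (rule eventually_mono) (auto intro: SUP_upper)
    fix x assume "x < (SUP s\<in>{0<..}. G s)"
    then obtain s where s: "0 < s" "x < G s" by (auto simp: less_SUP_iff)
    have "\<forall>\<^sub>F t in at_right 0. t < s" using s(1) by (intro eventually_at_rightI[of 0 s]) auto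
    then show "\<forall>\<^sub>F t in at_right 0. x < G t"
      by (rule eventually_mono) (meson anti less_imp_le less_le_trans s(2))
  qed
  then have "top_pressure X f \<phi> = (SUP s\<in>{0<..}. G s)"
    unfolding top_pressure_def G_def by (intro tendsto_Lim) auto
  moreover have "G r \<le> (SUP s\<in>{0<..}. G s)" using assms by (intro SUP_upper) auto
  ultimately show ?thesis by (simp add: G_def)
qed

section \<open>Comparison of the pressures\<close>

lemma birkhoff_sum_le_of_bowen_dist_less:
  assumes "nds X f" "x \<in> mspace (X 0)" "y \<in> mspace (X 0)" "bowen_dist X f n x y < r"
    and "\<And>i u v. u \<in> mspace (X i) \<Longrightarrow> v \<in> mspace (X i) \<Longrightarrow> mdist (X i) u v < r \<Longrightarrow> \<bar>\<phi> i u - \<phi> i v\<bar> < \<tau>"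
  shows "birkhoff_sum f \<phi> n y \<le> birkhoff_sum f \<phi> n x + real n * \<tau>"
proof -
  have "\<phi> i (nds_iter f 0 i y) \<le> \<phi> i (nds_iter f 0 i x) + \<tau>" if "i < n" for i
    using assms(5)[of "nds_iter f 0 i x" i "nds_iter f 0 i y"] assms(2-4) that
      nds_iter_in_mspace[OF assms(1)] by (fastforce simp: bowen_dist_less_iff)
  then have "birkhoff_sum f \<phi> n y \<le> (\<Sum>i<n. \<phi> i (nds_iter f 0 i x) + \<tau>)"
    unfolding birkhoff_sum_def by (intro sum_mono) auto
  then show ?thesis by (simp add: birkhoff_sum_def sum.distrib)
qed

text \<open>Finiteness allows this term to be moved across inequalities between extended reals.\<close>

lemma birkhoff_average_liminf_finite:
  assumes "nds X f" "ims X f \<mu>" "unif_equicontinuous X \<phi>" "unif_bounded X \<phi>"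
  shows "\<bar>liminf (\<lambda>n. ereal (1 / real n * (\<integral>x. birkhoff_sum f \<phi> n x \<partial>\<mu> 0)))\<bar> \<noteq> \<infinity>"
proof -
  interpret prob_space "\<mu> 0" using assms(2) by (simp add: ims_def)
  obtain C where C: "\<And>i x. x \<in> mspace (X i) \<Longrightarrow> \<bar>\<phi> i x\<bar> \<le> C"
    using assms(4) by (auto simp: unif_bounded_def)
  have sp: "space (\<mu> 0) = mspace (X 0)" using assms(2) by (simp add: ims_def)
  let ?b = "\<lambda>n. 1 / real n * (\<integral>x. birkhoff_sum f \<phi> n x \<partial>\<mu> 0)"
  have "\<bar>?b n\<bar> \<le> \<bar>C\<bar>" for n
  proof -
    have pt: "\<bar>birkhoff_sum f \<phi> n x\<bar> \<le> real n * \<bar>C\<bar>" if "x \<in> space (\<mu> 0)" for x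
    proof -
      have "\<bar>\<phi> i (nds_iter f 0 i x)\<bar> \<le> \<bar>C\<bar>" for i
        using C[OF nds_iter_in_mspace[OF assms(1)], of x i] that sp by simp
      then have "\<bar>birkhoff_sum f \<phi> n x\<bar> \<le> (\<Sum>i<n. \<bar>C\<bar>)"
        unfolding birkhoff_sum_def by (intro order_trans[OF sum_abs sum_mono])
      then show ?thesis by simp
    qed
    have "\<bar>\<integral>x. birkhoff_sum f \<phi> n x \<partial>\<mu> 0\<bar> \<le> (\<integral>x. \<bar>birkhoff_sum f \<phi> n x\<bar> \<partial>\<mu> 0)"
      by (rule integral_abs_bound)
    also have "\<dots> \<le> (\<integral>x. real n * \<bar>C\<bar> \<partial>\<mu> 0)"
      using pt integrable_birkhoff_sum[OF assms] by (intro integral_mono) auto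
    also have "\<dots> = real n * \<bar>C\<bar>" by (simp add: prob_space)
    finally show ?thesis by (cases "n = 0") (auto simp: abs_mult field_simps)
  qed
  then have b: "- \<bar>C\<bar> \<le> ?b n" "?b n \<le> \<bar>C\<bar>" for n by (simp_all only: abs_le_iff minus_le_iff)
  have "ereal (- \<bar>C\<bar>) \<le> liminf (\<lambda>n. ereal (?b n))"
    using b by (intro Liminf_bounded always_eventually) simp
  moreover have "liminf (\<lambda>n. ereal (?b n)) \<le> ereal \<bar>C\<bar>"
    using b by (intro order_trans[OF Liminf_le_Limsup Limsup_bounded] always_eventually) simp_all
  ultimately show ?thesis by auto
qed

text \<open>
  Per unit of time the finite-time estimate loses three things: the oscillation of the potential
  over a Bowen ball, the term \<open>- ln (1 - \<eta>)\<close>, and the cost \<open>N * \<kappa> * ln (N / \<eta>)\<close> of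
  the bad times. Choosing \<open>\<eta>\<close> first, then \<open>\<kappa>\<close>, and the radius last makes each at most
  \<open>\<tau> / 3\<close>.
\<close>

lemma entropy_wrt_le_top_pressure:
  assumes nds: "nds X f" and ims: "ims X f \<mu>"
    and \<phi>: "unif_equicontinuous X \<phi>" "unif_bounded X \<phi>"
    and P: "P \<in> admissible_M X \<mu>" and \<tau>: "0 < \<tau>"
  shows "entropy_wrt X f P \<mu> \<le> top_pressure X f \<phi>
    + (ereal \<tau> - liminf (\<lambda>n. ereal (1 / real n * (\<integral>x. birkhoff_sum f \<phi> n x \<partial>\<mu> 0))))"
proof -
  let ?b = "\<lambda>n. 1 / real n * (\<integral>x. birkhoff_sum f \<phi> n x \<partial>\<mu> 0)"
  define t where "t = \<tau> / 3"
  have t: "0 < t" "\<tau> = 3 * t" using \<tau> by (auto simp: t_def)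
  obtain N0 where N0: "\<And>n. card (P n) \<le> N0" using P by (auto simp: admissible_M_def)
  \<comment> \<open>The successor makes the bound positive, so that it can be divided by.\<close>
  define N where "N = Suc N0"
  have N: "1 \<le> N" "\<And>n. card (P n) \<le> N" using N0 by (auto simp: N_def le_SucI)
  define \<eta> where "\<eta> = 1 - exp (- t)"
  have \<eta>: "0 < \<eta>" "\<eta> < 1" "ln (1 - \<eta>) = - t" using t by (auto simp: \<eta>_def)
  define D where "D = real N * ln (real N / \<eta>)"
  have D: "0 \<le> D" using N \<eta> by (auto simp: D_def field_simps intro!: mult_nonneg_nonneg ln_ge_zero)
  define \<kappa> where "\<kappa> = t / (D + 1)"
  have "\<kappa> > 0" using t D by (simp add: \<kappa>_def)
  have "\<kappa> * D \<le> t" using t D by (simp add: \<kappa>_def field_simps)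
  then have \<kappa>D: "real N * \<kappa> * ln (real N / \<eta>) \<le> t" by (simp add: D_def algebra_simps)
  obtain \<delta> K where "\<delta> > 0" and K0: "\<forall>n. (\<forall>A\<in>P n. K n A \<subseteq> A \<and> compactin (mtopology_of (X n)) (K n A) \<and>
           measure (\<mu> n) (A - K n A) \<le> \<kappa>) \<and>
        (\<forall>A\<in>P n. \<forall>B\<in>P n. A \<noteq> B \<longrightarrow> (\<forall>x\<in>K n A. \<forall>y\<in>K n B. \<delta> \<le> mdist (X n) x y))"
  proof -
    have "\<exists>\<delta>>0. \<exists>K. \<forall>n. (\<forall>A\<in>P n. K n A \<subseteq> A \<and> compactin (mtopology_of (X n)) (K n A) \<and>
           measure (\<mu> n) (A - K n A) \<le> \<kappa>) \<and>
        (\<forall>A\<in>P n. \<forall>B\<in>P n. A \<noteq> B \<longrightarrow> (\<forall>x\<in>K n A. \<forall>y\<in>K n B. \<delta> \<le> mdist (X n) x y))"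
      using P \<open>\<kappa> > 0\<close> by (simp add: admissible_M_def)
    then show ?thesis by (elim exE conjE) (rule that)
  qed
  have K: "K n A \<subseteq> A \<and> compactin (mtopology_of (X n)) (K n A) \<and> measure (\<mu> n) (A - K n A) \<le> \<kappa>"
    if "A \<in> P n" for n A using K0 that by blast
  have K_sep: "\<delta> \<le> mdist (X n) x y"
    if "A \<in> P n" "B \<in> P n" "A \<noteq> B" "x \<in> K n A" "y \<in> K n B" for n A B x y
    using K0 that by blast
  obtain \<delta>' where "\<delta>' > 0" and \<delta>': "\<And>n x y. x \<in> mspace (X n) \<Longrightarrow> y \<in> mspace (X n) \<Longrightarrow>
        mdist (X n) x y < \<delta>' \<Longrightarrow> \<bar>\<phi> n x - \<phi> n y\<bar> < t"
    using \<phi>(1) t(1) unfolding unif_equicontinuous_def by meson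
  define r where "r = min (\<delta> / 2) \<delta>'"
  have r: "0 < r" "2 * r \<le> \<delta>" "r \<le> \<delta>'" using \<open>\<delta> > 0\<close> \<open>\<delta>' > 0\<close> by (auto simp: r_def)
  have step: "ereal (1 / real n * partition_entropy (\<mu> 0) (nds_join X f P n))
      \<le> ereal (1 / real n) * ln_ereal (sep_sum X f \<phi> n r) + (ereal \<tau> + - ereal (?b n))"
    if n: "0 < n" for n
  proof -
    obtain E where E: "finite E" "nds_separated X f n r E"
      "\<And>x. x \<in> mspace (X 0) \<Longrightarrow> \<exists>e\<in>E. bowen_dist X f n e x < r"
      using exists_separated_spanning_set[OF nds r(1)] by metis
    have E_sub: "E \<subseteq> mspace (X 0)" using E(2) by (simp add: nds_separated_def)
    define Z where "Z = (\<Sum>e\<in>E. exp (birkhoff_sum f \<phi> n e))"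
    have "prob_space (\<mu> 0)" "space (\<mu> 0) = mspace (X 0)" using ims by (auto simp: ims_def)
    then have "E \<noteq> {}" using E(3) prob_space.not_empty by blast
    then have Z: "0 < Z" unfolding Z_def using E(1) by (intro sum_pos) auto
    have "partition_entropy (\<mu> 0) (nds_join X f P n) + (\<integral>x. birkhoff_sum f \<phi> n x \<partial>\<mu> 0)
      \<le> ln (\<Sum>e\<in>E. exp (birkhoff_sum f \<phi> n e)) + real n * t
        + real n * (real N * \<kappa> * ln (real N / \<eta>) - ln (1 - \<eta>))"
    proof (rule entropy_plus_integral_le[OF nds ims _ N(2), where K = K and r = r])
      show "finite_borel_partition (X i) (P i)" for i using P by (simp add: admissible_M_def)
      show "2 * r \<le> mdist (X i) x y" if "A \<in> P i" "B \<in> P i" "A \<noteq> B" "x \<in> K i A" "y \<in> K i B" for i A B x y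
        using K_sep[OF that] r(2) by simp
      show "birkhoff_sum f \<phi> n x \<le> birkhoff_sum f \<phi> n e + real n * t"
        if "e \<in> E" "x \<in> mspace (X 0)" "bowen_dist X f n e x < r" for e x
        using that E_sub \<delta>' r(3) by (intro birkhoff_sum_le_of_bowen_dist_less[OF nds, where r = r]) auto
    qed (use K E E_sub \<eta> n integrable_birkhoff_sum[OF nds ims \<phi>] in auto)
    also have "\<dots> \<le> ln Z + real n * \<tau>"
    proof -
      have "real n * (real N * \<kappa> * ln (real N / \<eta>) - ln (1 - \<eta>)) \<le> real n * (2 * t)"
        using \<kappa>D \<eta>(3) by (intro mult_left_mono) auto
      then show ?thesis using t(2) by (simp add: Z_def algebra_simps)
    qed
    finally have "1 / real n * partition_entropy (\<mu> 0) (nds_join X f P n) \<le> 1 / real n * ln Z + (\<tau> - ?b n)"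
      using n by (simp add: field_simps)
    moreover have "ereal (1 / real n * ln Z) \<le> ereal (1 / real n) * ln_ereal (sep_sum X f \<phi> n r)"
    proof -
      have "ereal Z \<le> sep_sum X f \<phi> n r"
        unfolding sep_sum_def Z_def using E(2) by (intro SUP_upper2[of E]) auto
      then have "ereal (ln Z) \<le> ln_ereal (sep_sum X f \<phi> n r)"
        using ln_ereal_mono[of "ereal Z"] Z by (simp add: ln_ereal_def)
      then have "ereal (1 / real n) * ereal (ln Z) \<le> ereal (1 / real n) * ln_ereal (sep_sum X f \<phi> n r)"
        by (intro ereal_mult_left_mono) auto
      then show ?thesis by simp
    qed
    ultimately have "ereal (1 / real n * partition_entropy (\<mu> 0) (nds_join X f P n))
       \<le> ereal (1 / real n * ln Z) + ereal (\<tau> - ?b n)" by simp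
    also have "\<dots> \<le> ereal (1 / real n) * ln_ereal (sep_sum X f \<phi> n r) + ereal (\<tau> - ?b n)"
      by (intro add_right_mono) fact
    finally show ?thesis by simp
  qed
  \<comment> \<open>The integral term changes sides with a minus sign, so its upper limit becomes minus the
    lower limit that the metric pressure contains.\<close>
  have "entropy_wrt X f P \<mu>
      \<le> limsup (\<lambda>n. ereal (1 / real n) * ln_ereal (sep_sum X f \<phi> n r) + (ereal \<tau> + - ereal (?b n)))"
    unfolding entropy_wrt_def
    by (intro Limsup_mono eventually_mono[OF eventually_gt_at_top[of 0]]) (rule step)
  also have "\<dots> \<le> limsup (\<lambda>n. ereal (1 / real n) * ln_ereal (sep_sum X f \<phi> n r))
      + limsup (\<lambda>n. ereal \<tau> + - ereal (?b n))"
    by (rule ereal_limsup_add_mono)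
  also have "limsup (\<lambda>n. ereal \<tau> + - ereal (?b n)) = ereal \<tau> + limsup (\<lambda>n. - ereal (?b n))"
    by (rule Limsup_add_ereal_left) auto
  also have "limsup (\<lambda>n. - ereal (?b n)) = - liminf (\<lambda>n. ereal (?b n))"
    by (rule ereal_Limsup_uminus)
  also have "limsup (\<lambda>n. ereal (1 / real n) * ln_ereal (sep_sum X f \<phi> n r)) + (ereal \<tau> + - liminf (\<lambda>n. ereal (?b n)))
     \<le> top_pressure X f \<phi> + (ereal \<tau> + - liminf (\<lambda>n. ereal (?b n)))"
    by (intro add_right_mono limsup_sep_sum_le_top_pressure r(1))
  finally show ?thesis by (simp add: minus_ereal_def)
qed

theorem theorem3p6:
  fixes X :: "nat \<Rightarrow> 'a metric"
    and f :: "nat \<Rightarrow> 'a \<Rightarrow> 'a"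
    and \<mu> :: "nat \<Rightarrow> 'a measure"
    and \<phi> :: "nat \<Rightarrow> 'a \<Rightarrow> real"
  assumes "nds X f"
    and "nds_equicontinuous X f"
    and "ims X f \<mu>"
    and "unif_equicontinuous X \<phi>"
    and "unif_bounded X \<phi>"
  shows "metric_pressure X f \<mu> \<phi> \<le> top_pressure X f \<phi>"
proof -
  obtain l where l: "liminf (\<lambda>n. ereal (1 / real n * (\<integral>x. birkhoff_sum f \<phi> n x \<partial>\<mu> 0))) = ereal l"
    using birkhoff_average_liminf_finite[OF assms(1,3-5)] by (auto elim: abs_neq_infinity_cases)
  have "entropy_wrt X f P \<mu> \<le> top_pressure X f \<phi> - ereal l" if "P \<in> admissible_M X \<mu>" for P
  proof (rule ereal_le_epsilon2)
    fix \<tau> :: real assume "0 < \<tau>"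
    then have "entropy_wrt X f P \<mu> \<le> top_pressure X f \<phi> + (ereal \<tau> - ereal l)"
      using entropy_wrt_le_top_pressure[OF assms(1,3-5) that] l by metis
    also have "\<dots> = top_pressure X f \<phi> - ereal l + ereal \<tau>"
      by (cases "top_pressure X f \<phi>") auto
    finally show "entropy_wrt X f P \<mu> \<le> top_pressure X f \<phi> - ereal l + ereal \<tau>" .
  qed
  then have "metric_entropy X f \<mu> \<le> top_pressure X f \<phi> - ereal l"
    unfolding metric_entropy_def by (rule SUP_least)
  then have "metric_entropy X f \<mu> + ereal l \<le> top_pressure X f \<phi> - ereal l + ereal l"
    by (rule add_right_mono)
  also have "\<dots> = top_pressure X f \<phi>"
    by (cases "top_pressure X f \<phi>") auto
  finally show ?thesis unfolding metric_pressure_def l .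
qed

end
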